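(* Let $G$ be a $k$-uniform block graph. Then $\overrightarrow{\chi}(G)\leq 3k-2$.
   Context: An orientation $D$ of a graph $G$ replaces each edge by exactly one of its two possible arcs; $d^-_D(v)$ is the indegree of $v$. $D$ is proper if adjacent vertices have distinct indegrees; a $k$-orientation has maximum indegree at most $k$. $\overrightarrow{\chi}(G)$ is the minimum $k$ such that $G$ admits a proper $k$-orientation. A block graph is a graph whose 2-connected components (blocks) are complete graphs; it is $k$-uniform if every block has exactly $k=\omega(G)$ vertices. *)

theory Defs
  imports "Graph_Theory.Graph_Theory"
begin

text \<open>
  A finite simple undirected graph is modelled as in \<^locale>\<open>graph\<close>: a finite symmetric
  digraph without loops and parallel arcs, so that an edge between \<open>u\<close> and \<open>v\<close> is the pair of
  arcs \<open>u \<rightarrow> v\<close> and \<open>v \<rightarrow> u\<close>. The null graph is allowed by \<^locale>\<open>graph\<close>.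
\<close>

definition orientation :: "('a, 'b) pre_digraph \<Rightarrow> ('a, 'b) pre_digraph \<Rightarrow> bool" where
  "orientation G D \<longleftrightarrow> spanning D G \<and>
     (\<forall>u v. u \<rightarrow>\<^bsub>G\<^esub> v \<longrightarrow> (u \<rightarrow>\<^bsub>D\<^esub> v \<and> \<not> v \<rightarrow>\<^bsub>D\<^esub> u) \<or> (\<not> u \<rightarrow>\<^bsub>D\<^esub> v \<and> v \<rightarrow>\<^bsub>D\<^esub> u))"

definition proper_orientation :: "('a, 'b) pre_digraph \<Rightarrow> ('a, 'b) pre_digraph \<Rightarrow> bool" where
  "proper_orientation G D \<longleftrightarrow> orientation G D \<and>
     (\<forall>u v. u \<rightarrow>\<^bsub>G\<^esub> v \<longrightarrow> in_degree D u \<noteq> in_degree D v)"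

definition proper_k_orientation :: "nat \<Rightarrow> ('a, 'b) pre_digraph \<Rightarrow> ('a, 'b) pre_digraph \<Rightarrow> bool" where
  "proper_k_orientation k G D \<longleftrightarrow> proper_orientation G D \<and> (\<forall>v\<in>verts G. in_degree D v \<le> k)"

definition proper_orientation_number :: "('a, 'b) pre_digraph \<Rightarrow> nat" where
  "proper_orientation_number G = (LEAST k. \<exists>D. proper_k_orientation k G D)"

definition clique_number :: "('a, 'b) pre_digraph \<Rightarrow> nat" where
  "clique_number G = Max {n. \<exists>H. subgraph H G \<and> complete_digraph n H}"

text \<open>A vertex whose deletion disconnects two other vertices of its component.\<close>

definition cut_vertex :: "('a, 'b) pre_digraph \<Rightarrow> 'a \<Rightarrow> bool" where
  "cut_vertex G v \<longleftrightarrow> v \<in> verts G \<and>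
     (\<exists>u\<in>verts G - {v}. \<exists>w\<in>verts G - {v}.
        u \<rightarrow>\<^sup>*\<^bsub>G\<^esub> w \<and> \<not> u \<rightarrow>\<^sup>*\<^bsub>pre_digraph.del_vert G v\<^esub> w)"

text \<open>
  A block is a maximal connected subgraph without a cut vertex. As usual, a bridge together with its
  ends, and likewise an isolated vertex, is a block.
\<close>

definition block :: "('a, 'b) pre_digraph \<Rightarrow> ('a, 'b) pre_digraph \<Rightarrow> bool" where
  "block G B \<longleftrightarrow>
     pre_digraph.max_subgraph G (\<lambda>H. graph H \<and> connected H \<and> (\<nexists>v. cut_vertex H v)) B"

definition block_graph :: "('a, 'b) pre_digraph \<Rightarrow> bool" where
  "block_graph G \<longleftrightarrow> graph G \<and> (\<forall>B. block G B \<longrightarrow> (\<exists>n. complete_digraph n B))"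

definition uniform_block_graph :: "nat \<Rightarrow> ('a, 'b) pre_digraph \<Rightarrow> bool" where
  "uniform_block_graph k G \<longleftrightarrow>
     block_graph G \<and> k = clique_number G \<and> (\<forall>B. block G B \<longrightarrow> card (verts B) = k)"

end

theory Submission
  imports Defs
begin

text \<open>
  Root every component and consider breadth-first levels. The vertex set of a cycle induces a
  connected subgraph without a cut vertex, hence a clique; therefore every non-root vertex has
  exactly one neighbour on the previous level, and its block consists of this parent and of \<open>k - 1\<close>
  mutually adjacent vertices on its own level, which we call a class.

  Orient each block transitively. A vertex at position \<open>j\<close> of its parent block gets \<open>j\<close> arcs from
  there, and its indegree can be raised further by moving it up in the blocks below it. Going bottom
  up, each class turns out to be of one of three kinds, according to the pairs of position and
  indegree that it tolerates at its parent: it behaves like a class of simplicial vertices, or like a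
  class of vertices each having at least one such class below, or it tolerates every indegree of a
  parent at position 0. In the last case the indegrees in the class are taken from the three intervals
  \<open>{1..k-1}\<close>, \<open>{k..2k-2}\<close>, \<open>{2k-1..3k-3}\<close>, each of length \<open>k - 1\<close>: a vertex at position \<open>j\<close>
  gets the \<open>j\<close>-th value of its interval, and since not all vertices of the class have to use the
  same interval, a clash with the parent can be avoided.
\<close>

section \<open>Labelling a rooted forest of blocks\<close>

lemma bij_betw_fixing:
  assumes "finite A" "finite B" "card A = card B" "x \<in> A" "y \<in> B"
  obtains f where "bij_betw f A B" "f x = y"
proof -
  have "card (A - {x}) = card (B - {y})"
    using assms by simp
  then obtain g where g: "bij_betw g (A - {x}) (B - {y})"
    using assms finite_same_card_bij by (metis finite_Diff)
  have "bij_betw (g(x := y)) A B"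
    using g assms(4,5) by (auto simp: bij_betw_def inj_on_def)
  then show ?thesis
    using that[of "g(x := y)"] by simp
qed

text \<open>Both \<open>i - 1\<close> and \<open>j - 1\<close> are residues modulo
  \<open>k - 1\<close>. Hence vertices at different positions never share an indegree, whichever
  intervals they use.\<close>

lemma digit_unique:
  fixes a b k i j :: nat
  assumes "i \<in> {1..<k}" "j \<in> {1..<k}" "a * (k - 1) + i = b * (k - 1) + j"
  shows "i = j"
proof -
  have "(a * (k - 1) + (i - 1)) mod (k - 1) = (b * (k - 1) + (j - 1)) mod (k - 1)"
    using assms by (intro arg_cong[where f = "\<lambda>n. n mod (k - 1)"]) auto
  moreover have "i - 1 < k - 1" "j - 1 < k - 1" using assms by auto
  ultimately have "i - 1 = j - 1" by simp
  then show ?thesis using assms by auto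
qed

text \<open>If the parent holds the missing position \<open>b\<close>, adding it back makes exactly
  \<open>n\<close> vertices of the block precede position \<open>n\<close>.\<close>

lemma card_lessThan_vimage:
  fixes J :: "'a \<Rightarrow> nat"
  assumes "bij_betw J C ({..<k} - {b})" "n \<le> k"
  shows "card {u \<in> C. J u < n} = (if b < n then n - 1 else n)"
proof -
  have "card {u \<in> C. J u < n} = card (J ` {u \<in> C. J u < n})"
    using assms(1) by (intro card_image[symmetric]) (auto simp: bij_betw_def inj_on_def)
  also have "J ` {u \<in> C. J u < n} = {i \<in> J ` C. i < n}" by auto
  also have "\<dots> = {..<n} - {b}" using assms by (auto simp: bij_betw_def)
  finally show ?thesis by simp
qed

section \<open>Rooted forests of blocks\<close>

locale block_forest =
  fixes V :: "'a set" and k :: nat and lev :: "'a \<Rightarrow> nat"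
    and par :: "'a \<Rightarrow> 'a" and cls :: "'a \<Rightarrow> 'a set"
  assumes finite_V: "finite V"
    and par_in: "\<lbrakk>v \<in> V; 0 < lev v\<rbrakk> \<Longrightarrow> par v \<in> V"
    and lev_par: "\<lbrakk>v \<in> V; 0 < lev v\<rbrakk> \<Longrightarrow> lev v = Suc (lev (par v))"
    and cls_self: "\<lbrakk>v \<in> V; 0 < lev v\<rbrakk> \<Longrightarrow> v \<in> cls v"
    and cls_sub: "\<lbrakk>v \<in> V; 0 < lev v\<rbrakk> \<Longrightarrow> cls v \<subseteq> V"
    and cls_mem: "\<lbrakk>v \<in> V; 0 < lev v; u \<in> cls v\<rbrakk> \<Longrightarrow> lev u = lev v \<and> par u = par v \<and> cls u = cls v"
    and card_cls: "\<lbrakk>v \<in> V; 0 < lev v\<rbrakk> \<Longrightarrow> Suc (card (cls v)) = k"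
begin

definition classes :: "'a \<Rightarrow> 'a set set" where
  "classes v = cls ` {w \<in> V. 0 < lev w \<and> par w = v}"

lemma finite_classes: "finite (classes v)"
  using finite_V by (simp add: classes_def)

lemma classesD:
  assumes "C \<in> classes v"
  shows "C \<subseteq> V" "finite C" "C \<noteq> {}" "Suc (card C) = k" "2 \<le> k"
    "w \<in> C \<Longrightarrow> lev w = Suc (lev v) \<and> par w = v \<and> cls w = C"
proof -
  obtain u where u: "u \<in> V" "0 < lev u" "par u = v" "C = cls u"
    using assms by (auto simp: classes_def)
  show "C \<subseteq> V" using u cls_sub by auto
  then show fin: "finite C" using finite_V finite_subset by blast
  show ne: "C \<noteq> {}" using u cls_self by auto
  show cd: "Suc (card C) = k" using u card_cls by auto
  show "2 \<le> k" using cd fin ne by (metis Suc_leI card_gt_0_iff not_less_eq_eq numeral_2_eq_2)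
  show "w \<in> C \<Longrightarrow> lev w = Suc (lev v) \<and> par w = v \<and> cls w = C"
    using u cls_mem[of u w] lev_par[of u] by auto
qed

lemma disjoint_classes: "\<lbrakk>C \<in> classes v; D \<in> classes u; w \<in> C; w \<in> D\<rbrakk> \<Longrightarrow> C = D"
  using classesD(6) by metis

lemma cls_in_classes: "\<lbrakk>v \<in> V; 0 < lev v\<rbrakk> \<Longrightarrow> cls v \<in> classes (par v)"
  by (auto simp: classes_def)

text \<open>
  \<open>vfeas v j c\<close>: the part of the graph hanging below \<open>v\<close> can be oriented properly so that \<open>v\<close> gets
  indegree \<open>c\<close> when \<open>j\<close> of its incoming arcs come from its parent block.
  \<open>bfeas C a c\<close>: the same for the block formed by \<open>C\<close> and its parent, where the parent has
  indegree \<open>c\<close>, of which \<open>a\<close> arcs come from \<open>C\<close>. Blocks are oriented transitively, so an orientation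
  of a block is given by the positions \<open>pos\<close> of its vertices.
\<close>

inductive vfeas :: "'a \<Rightarrow> nat \<Rightarrow> nat \<Rightarrow> bool"
  and bfeas :: "'a set \<Rightarrow> nat \<Rightarrow> nat \<Rightarrow> bool" where
  vfeasI: "\<lbrakk>c \<le> 3 * k - 2; c = j + (\<Sum>C\<in>classes v. a C); \<forall>C\<in>classes v. bfeas C (a C) c\<rbrakk>
    \<Longrightarrow> vfeas v j c"
| bfeasI: "\<lbrakk>a < k; bij_betw pos C ({..<k} - {a}); inj_on col C; c \<notin> col ` C;
    \<forall>w\<in>C. vfeas w (pos w) (col w)\<rbrakk> \<Longrightarrow> bfeas C a c"

section \<open>Feasible indegrees: kinds of classes and types of vertices\<close>

lemma vfeas_on:
  assumes "S \<subseteq> classes v" "\<And>C. C \<in> S \<Longrightarrow> bfeas C (a C) c"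
    "\<And>C. C \<in> classes v - S \<Longrightarrow> bfeas C 0 c" "c = j + sum a S" "c \<le> 3 * k - 2"
  shows "vfeas v j c"
proof (rule vfeasI[where a = "\<lambda>C. if C \<in> S then a C else 0"])
  show "c = j + (\<Sum>C\<in>classes v. if C \<in> S then a C else 0)"
    using assms(1,4) finite_classes[of v] by (simp add: sum.If_cases Int_absorb1)
qed (use assms in auto)

text \<open>
  The model of \<open>leafy\<close> is a class of simplicial vertices, the model of \<open>stem\<close> a class in which every
  vertex has \<open>leafy\<close> classes, and otherwise only \<open>free\<close> ones, below.
\<close>

definition leafy where
  "leafy C \<longleftrightarrow> (\<forall>a<k. \<forall>c. k \<le> c \<or> c = a \<longrightarrow> bfeas C a c)"
definition stem where
  "stem C \<longleftrightarrow> (\<forall>c. c < k \<or> 2 * k - 1 \<le> c \<longrightarrow> bfeas C 0 c) \<and>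
     (\<forall>a<k. \<forall>c\<ge>2 * k - 1. bfeas C a c) \<and> bfeas C 1 k"
definition free where
  "free C \<longleftrightarrow> (\<forall>c. bfeas C 0 c)"

text \<open>
  A vertex is of \<open>type0\<close> if no class below it is \<open>leafy\<close>, of \<open>type1\<close> if some is and all others are
  \<open>leafy\<close> or \<open>free\<close>, and of \<open>type2\<close> if both \<open>leafy\<close> and \<open>stem\<close> classes occur. The last disjunction is
  the way out when all vertices of a class are of \<open>type2\<close> and one of them clashes with the parent.
\<close>

definition type0 where
  "type0 v \<longleftrightarrow> (\<forall>j<k. vfeas v j j)"
definition type1 where
  "type1 v \<longleftrightarrow> vfeas v 0 0 \<and> (\<forall>j\<in>{1..<k}. vfeas v j (k - 1 + j))"
definition type2 where
  "type2 v \<longleftrightarrow> (\<forall>j\<in>{1..<k}. vfeas v j (2 * (k - 1) + j)) \<and>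
     ((\<forall>j\<in>{1..<k}. vfeas v j k) \<or> (\<forall>j\<in>{1..<k}. vfeas v j (3 * k - 2)))"

text \<open>The parent takes position 0 and \<open>x\<close> takes position \<open>i\<close> with
  the special value \<open>d\<close>; any other \<open>w\<close> at position \<open>j\<close> takes
  the \<open>j\<close>-th value of interval \<open>h w\<close>. By \<open>digit_unique\<close> these
  values differ pairwise, so only clashes with \<open>c\<close> and \<open>d\<close> must be
  excluded.\<close>

lemma bfeas_by_height:
  assumes C: "finite C" "Suc (card C) = k"
    and x: "x \<in> C" "i \<in> {1..<k}" "vfeas x i d" "d \<noteq> c"
    and h: "\<And>w j. \<lbrakk>w \<in> C - {x}; j \<in> {1..<k}\<rbrakk> \<Longrightarrow> vfeas w j (h w * (k - 1) + j)"
    and nc: "\<And>w j. \<lbrakk>w \<in> C - {x}; j \<in> {1..<k} - {i}\<rbrakk> \<Longrightarrow> h w * (k - 1) + j \<notin> {c, d}"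
  shows "bfeas C 0 c"
proof -
  have "card C = card {1..<k}" using C(2) by auto
  then obtain pos where pos: "bij_betw pos C {1..<k}" "pos x = i"
    using C x by (meson bij_betw_fixing finite_atLeastLessThan)
  have pos_range: "pos w \<in> {1..<k}" if "w \<in> C" for w
    using pos(1) that by (auto simp: bij_betw_def)
  have pos_inj: "pos w \<noteq> pos u" if "w \<in> C" "u \<in> C" "w \<noteq> u" for w u
    using pos(1) that by (auto simp: bij_betw_def inj_on_def)
  define col where "col w = (if w = x then d else h w * (k - 1) + pos w)" for w
  have col_other: "col w \<notin> {c, d}" if "w \<in> C - {x}" for w
    using nc[of w "pos w"] pos_range[of w] pos_inj[of w x] that x pos(2)
    by (auto simp: col_def)
  have "inj_on col C"
  proof (rule inj_onI, rule ccontr)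
    fix u w assume uw: "u \<in> C" "w \<in> C" "col u = col w" "u \<noteq> w"
    then have "u \<noteq> x" "w \<noteq> x" using col_other by (auto simp: col_def split: if_splits)
    then have "pos u = pos w"
      using uw digit_unique[OF pos_range pos_range] by (simp add: col_def)
    then show False using pos_inj uw by blast
  qed
  moreover have "c \<notin> col ` C" using col_other x by (auto simp: col_def)
  moreover have "\<forall>w\<in>C. vfeas w (pos w) (col w)"
    using h pos_range pos x by (auto simp: col_def)
  moreover have "{1..<k} = {..<k} - {0}" by auto
  ultimately show ?thesis
    using bfeasI[of 0 pos C col c] pos(1) C(2) by auto
qed

lemma class_cases:
  assumes C: "finite C" "C \<noteq> {}" "Suc (card C) = k" "2 \<le> k"
    and ty: "\<And>w. w \<in> C \<Longrightarrow> type0 w \<or> type1 w \<or> type2 w"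
  shows "leafy C \<or> stem C \<or> free C"
proof -
  have ex_pos: "\<exists>pos. bij_betw pos C ({..<k} - {a})" if "a < k" for a
    using that C by (intro finite_same_card_bij) auto
  consider (l) "\<forall>w\<in>C. type0 w" | (s) "\<forall>w\<in>C. type1 w"
    | (f) "\<exists>w\<in>C. \<not> type0 w" "\<exists>w\<in>C. \<not> type1 w" by blast
  then show ?thesis
  proof cases
    case l
    have "bfeas C a c" if ac: "a < k" "k \<le> c \<or> c = a" for a c
    proof -
      obtain pos where pos: "bij_betw pos C ({..<k} - {a})" using ex_pos[OF ac(1)] by blast
      then show ?thesis
        using ac pos l by (intro bfeasI[where pos = pos and col = pos])
          (auto simp: bij_betw_def type0_def)
    qed
    then show ?thesis by (auto simp: leafy_def)
  next
    case s
    have "bfeas C a c"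
      if ac: "a < k" "(a = 0 \<and> c < k) \<or> 2 * k - 1 \<le> c \<or> a = 1 \<and> c = k" for a c
    proof -
      obtain pos where pos: "bij_betw pos C ({..<k} - {a})" using ex_pos[OF ac(1)] by blast
      \<comment> \<open>Position 0 keeps indegree 0, the others use the middle interval. The value
        \<open>k\<close> belongs to position 1, so it becomes free for the parent when
        \<open>a = 1\<close>.\<close>
      let ?col = "\<lambda>w. if pos w = 0 then 0 else k - 1 + pos w"
      have posC: "pos w < k \<and> pos w \<noteq> a" if "w \<in> C" for w
        using pos that by (auto simp: bij_betw_def)
      show ?thesis
      proof (rule bfeasI[where pos = pos and col = ?col])
        show "inj_on ?col C"
          using pos by (auto simp: bij_betw_def inj_on_def split: if_splits)
        show "\<forall>w\<in>C. vfeas w (pos w) (?col w)"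
        proof
          fix w assume w: "w \<in> C"
          then have "pos w \<in> {1..<k}" if "pos w \<noteq> 0" using posC that by auto
          then show "vfeas w (pos w) (?col w)"
            using s w unfolding type1_def by (cases "pos w = 0") (metis, metis)
        qed
        show "c \<notin> ?col ` C"
        proof
          assume "c \<in> ?col ` C"
          then obtain w where w: "w \<in> C" "c = ?col w" by blast
          have "pos w < k" "pos w \<noteq> a" using posC w(1) by auto
          then show False
            using w(2) ac(2) C(4) by (cases "pos w = 0") auto
        qed
      qed (use ac pos in auto)
    qed
    then show ?thesis using C(4) by (auto simp: stem_def)
  next
    case f
    define h where "h w = (if type0 w then 0 else if type1 w then 1 else 2 :: nat)" for w
    have h: "vfeas w j (h w * (k - 1) + j)" if "w \<in> C" "j \<in> {1..<k}" for w j
      using ty[OF that(1)] that(2)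
      by (auto simp: h_def type0_def type1_def type2_def)
    have h2: "h w \<le> 2" for w by (simp add: h_def)
    have "bfeas C 0 c" for c
    proof (cases "c = 0 \<or> 3 * k - 2 \<le> c")
      case True
      obtain x where x: "x \<in> C" using C(2) by blast
      \<comment> \<open>Here \<open>c\<close> lies outside all three intervals, so the parent cannot
        clash.\<close>
      have out: "h w * (k - 1) + j \<noteq> c" if "j \<in> {1..<k}" for w j
      proof -
        have "h w * (k - 1) \<le> 2 * (k - 1)" using h2 by (intro mult_right_mono) auto
        then show ?thesis using that True C(4) unfolding atLeastLessThan_iff by linarith
      qed
      show ?thesis
      proof (rule bfeas_by_height[where x = x and i = 1 and d = "h x * (k - 1) + 1" and h = h])
        show "h w * (k - 1) + j \<notin> {c, h x * (k - 1) + 1}"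
          if "w \<in> C - {x}" "j \<in> {1..<k} - {1}" for w j
          using out[of j w] digit_unique[of j k 1 "h w" "h x"] that C(4) by fastforce
      qed (use C x h h[of x 1] out[of 1 x] in auto)
    next
      case False
      \<comment> \<open>\<open>c\<close> is the \<open>i\<close>-th value of interval
        \<open>q\<close>, shifted by one because positions start at 1. Only the vertex at position
        \<open>i\<close> can clash, so a vertex with \<open>h x \<noteq> q\<close> is put there if
        one exists.\<close>
      define q where "q = (c - 1) div (k - 1)"
      define i where "i = (c - 1) mod (k - 1) + 1"
      have "q * (k - 1) + (i - 1) = c - 1"
        unfolding q_def i_def by (metis add_diff_cancel_right' div_mult_mod_eq)
      moreover have "0 < c" "0 < i" using False by (auto simp: i_def)
      ultimately have c: "c = q * (k - 1) + i" by linarith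
      have "i - 1 < k - 1" using C(4) by (simp add: i_def)
      with \<open>0 < i\<close> have i: "i \<in> {1..<k}" by auto
      have "c - 1 < 3 * (k - 1)" using False C(4) by auto
      then have q: "q < 3" using C(4) by (simp add: q_def less_mult_imp_div_less)
      have other: "h w * (k - 1) + j \<noteq> p * (k - 1) + i" if "j \<in> {1..<k} - {i}" for w j p
        using digit_unique[of j k i] that i by blast
      have from_shift: "bfeas C 0 c" if "x \<in> C" "vfeas x i (p * (k - 1) + i)" "p \<noteq> q" for x p
      proof (rule bfeas_by_height[where x = x and i = i and d = "p * (k - 1) + i" and h = h])
        show "p * (k - 1) + i \<noteq> c" using c that(3) C(4) by auto
      qed (use C h that i c other in auto)
      show ?thesis
      proof (cases "\<exists>x\<in>C. h x \<noteq> q")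
        case True
        then show ?thesis using h[OF _ i] from_shift by blast
      next
        case all: False
        obtain x y where x: "x \<in> C" "\<not> type0 x" and y: "y \<in> C" "\<not> type1 y" using f by blast
        have "q \<noteq> 0" using all x by (auto simp: h_def split: if_splits)
        then consider "q = 1" | "q = 2" using q by linarith
        then show ?thesis
        proof cases
          case 1
          then show ?thesis using all y by (auto simp: h_def split: if_splits)
        next
          case 2
          \<comment> \<open>All vertices use the top interval. The one at position \<open>i\<close>
            escapes to \<open>k\<close>, below that interval, or to \<open>3 * k - 2\<close>, above
            it.\<close>
          then have "type2 x" using all x ty[OF x(1)] by (auto simp: h_def split: if_splits)
          then obtain d where d: "vfeas x i d" "d = k \<or> d = 3 * k - 2" using i unfolding type2_def by blast
          have "h w = 2" if "w \<in> C" for w using all 2 that by auto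
          then show ?thesis
            using C x h i d c 2 other[where p = 2]
            by (intro bfeas_by_height[where x = x and i = i and d = d and h = h]) auto
        qed
      qed
    qed
    then show ?thesis by (auto simp: free_def)
  qed
qed

text \<open>The indegree of \<open>v\<close> is raised inside selected classes, all others keeping
  \<open>v\<close> at position 0. A \<open>leafy\<close> class can contribute any
  \<open>a < k\<close> once the total reaches \<open>k\<close>, a \<open>stem\<close> class once it
  reaches \<open>2 * k - 1\<close>.\<close>

lemma vertex_cases:
  assumes ty: "\<And>C. C \<in> classes v \<Longrightarrow> leafy C \<or> stem C \<or> free C"
  shows "vfeas v 0 0" "type0 v \<or> type1 v \<or> type2 v"
proof -
  have low: "bfeas C 0 j" if "C \<in> classes v" "j < k" "\<not> leafy C \<or> j = 0" for C j
    using ty[OF that(1)] that by (auto simp: leafy_def stem_def free_def)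
  have mid: "bfeas C 0 c" if "C \<in> classes v" "k \<le> c" "leafy C \<or> \<not> stem C" for C c
    using ty[OF that(1)] classesD(5)[OF that(1)] that by (auto simp: leafy_def stem_def free_def)
  have high: "bfeas C 0 c" if "C \<in> classes v" "2 * k - 1 \<le> c" for C c
    using ty[OF that(1)] classesD(5)[OF that(1)] that by (auto simp: leafy_def stem_def free_def)
  show v0: "vfeas v 0 0"
    by (rule vfeas_on[where S = "{}"]) (use low classesD(5) in force)+
  have "type0 v" if "\<And>C. C \<in> classes v \<Longrightarrow> \<not> leafy C"
    unfolding type0_def
  proof (intro allI impI)
    fix j assume "j < k"
    then show "vfeas v j j"
      by (intro vfeas_on[where S = "{}"]) (use low that in auto)
  qed
  moreover have "type1 v \<or> type2 v" if L: "L \<in> classes v" "leafy L" for L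
  proof -
    note k = classesD(5)[OF L(1)]
    have lf: "bfeas L a c" if "a < k" "k \<le> c" for a c using L that by (auto simp: leafy_def)
    show ?thesis
    proof (cases "\<exists>T\<in>classes v. stem T \<and> \<not> leafy T")
      case False
      have "vfeas v j (k - 1 + j)" if "j \<in> {1..<k}" for j
        by (rule vfeas_on[where S = "{L}" and a = "\<lambda>_. k - 1"]) (use that False L lf mid in auto)
      then show ?thesis using v0 by (auto simp: type1_def)
    next
      case True
      then obtain T where T: "T \<in> classes v" "stem T" "\<not> leafy T" by blast
      have "L \<noteq> T" using L T by auto
      have st: "bfeas C a c" if "stem C" "a < k" "2 * k - 1 \<le> c" for C a c
        using that by (auto simp: stem_def)
      have "vfeas v j (2 * (k - 1) + j)" if "j \<in> {1..<k}" for j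
        by (rule vfeas_on[where S = "{L, T}" and a = "\<lambda>_. k - 1"])
          (use that k L(1) T(1) \<open>L \<noteq> T\<close> lf st[OF T(2)] high in auto)
      moreover have "(\<forall>j\<in>{1..<k}. vfeas v j k) \<or> (\<forall>j\<in>{1..<k}. vfeas v j (3 * k - 2))"
      proof (cases "\<exists>U\<in>classes v. stem U \<and> \<not> leafy U \<and> U \<noteq> T")
        case False
        \<comment> \<open>\<open>T\<close> is the only \<open>stem\<close> class that is not
          \<open>leafy\<close>, so all classes but \<open>L\<close> and \<open>T\<close> accept
          \<open>k\<close> at position 0. The total is
          \<open>j + (k - 1 - j) + 1 = k\<close>.\<close>
        have "bfeas T 1 k" using T by (simp add: stem_def)
        moreover have "bfeas C 0 k" if "C \<in> classes v - {L, T}" for C using mid that False by auto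
        ultimately have "vfeas v j k" if "j \<in> {1..<k}" for j
          by (intro vfeas_on[where S = "{L, T}" and a = "(\<lambda>_. k - 1 - j)(T := 1)"])
            (use that L(1) T(1) \<open>L \<noteq> T\<close> lf in auto)
        then show ?thesis by blast
      next
        case True
        then obtain U where U: "U \<in> classes v" "stem U" "\<not> leafy U" "U \<noteq> T" by blast
        then have "L \<noteq> U" using L by auto
        \<comment> \<open>The total is \<open>j + (k - j) + 2 * (k - 1)\<close>; the share
          \<open>k - j\<close> is a legal position because \<open>j \<ge> 1\<close>.\<close>
        have "vfeas v j (3 * k - 2)" if "j \<in> {1..<k}" for j
          by (rule vfeas_on[where S = "{L, T, U}" and a = "(\<lambda>_. k - 1)(L := k - j)"])
            (use that k L(1) T(1) U(1,4) \<open>L \<noteq> T\<close> \<open>L \<noteq> U\<close> lf st[OF T(2)] st[OF U(2)] high in auto)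
        then show ?thesis by blast
      qed
      ultimately show ?thesis by (auto simp: type2_def)
    qed
  qed
  ultimately show "type0 v \<or> type1 v \<or> type2 v" by blast
qed

text \<open>Induction from the deepest level upwards, alternating \<open>class_cases\<close> and
  \<open>vertex_cases\<close>. The pair \<open>(0, 0)\<close> suits a root, which has no parent
  block.\<close>

lemma vfeas_root:
  assumes "v \<in> V"
  shows "vfeas v 0 0"
proof -
  obtain N where N: "\<And>w. w \<in> V \<Longrightarrow> lev w \<le> N"
    using finite_V by (meson finite_imageI finite_nat_set_iff_bounded_le imageI)
  have "\<forall>C\<in>classes v. leafy C \<or> stem C \<or> free C" if "v \<in> V" for v
    using that
  proof (induction "N - lev v" arbitrary: v rule: less_induct)
    case less
    show ?case
    proof
      fix C assume C: "C \<in> classes v"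
      show "leafy C \<or> stem C \<or> free C"
      proof (rule class_cases)
        fix w assume w: "w \<in> C"
        then have "w \<in> V" "lev w = Suc (lev v)" using classesD[OF C] by auto
        then have "\<forall>D\<in>classes w. leafy D \<or> stem D \<or> free D"
          using less(1)[of w] N[of w] by simp
        then show "type0 w \<or> type1 w \<or> type2 w" by (intro vertex_cases(2)) blast
      qed (use classesD[OF C] in auto)
    qed
  qed
  then show ?thesis using assms by (intro vertex_cases(1)) blast
qed

section \<open>From feasible pairs to a proper orientation\<close>

definition adj :: "'a \<Rightarrow> 'a \<Rightarrow> bool" where
  "adj u w \<longleftrightarrow> u \<in> V \<and> w \<in> V \<and> u \<noteq> w \<and>
     (0 < lev u \<and> 0 < lev w \<and> cls u = cls w \<or> 0 < lev w \<and> par w = u \<or> 0 < lev u \<and> par u = w)"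

text \<open>
  \<open>J\<close> is the position in the parent block, \<open>col\<close> the indegree, and \<open>B v C\<close> the position of \<open>v\<close> in the
  block formed with the class \<open>C\<close>.
\<close>

lemma exists_labelling:
  obtains J col :: "'a \<Rightarrow> nat" and B :: "'a \<Rightarrow> 'a set \<Rightarrow> nat" where
    "\<And>v. \<lbrakk>v \<in> V; lev v = 0\<rbrakk> \<Longrightarrow> J v = 0"
    "\<And>v. v \<in> V \<Longrightarrow> col v \<le> 3 * k - 2 \<and> col v = J v + (\<Sum>C\<in>classes v. B v C)"
    "\<And>v C. \<lbrakk>v \<in> V; C \<in> classes v\<rbrakk> \<Longrightarrow>
       B v C < k \<and> bij_betw J C ({..<k} - {B v C}) \<and> inj_on col C \<and> col v \<notin> col ` C"
proof -
  \<comment> \<open>One unfolding of feasibility as data: \<open>s\<close> and \<open>p w\<close>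
    are pairs of position and indegree, of \<open>v\<close> and of the vertices below it, and
    \<open>a\<close> gives the positions of \<open>v\<close> in the blocks below.\<close>
  define good where "good v s a p \<longleftrightarrow>
      snd s \<le> 3 * k - 2 \<and> snd s = fst s + (\<Sum>C\<in>classes v. a C) \<and>
      (\<forall>C\<in>classes v. a C < k \<and> bij_betw (fst \<circ> p) C ({..<k} - {a C}) \<and> inj_on (snd \<circ> p) C \<and>
         snd s \<notin> (snd \<circ> p) ` C \<and> (\<forall>w\<in>C. vfeas w (fst (p w)) (snd (p w))))"
    for v and s :: "nat \<times> nat" and a and p :: "'a \<Rightarrow> nat \<times> nat"
  have "\<exists>a p. good v s a p" if vf: "vfeas v (fst s) (snd s)" for v s
  proof -
    obtain a where a: "snd s \<le> 3 * k - 2" "snd s = fst s + (\<Sum>C\<in>classes v. a C)"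
        "\<And>C. C \<in> classes v \<Longrightarrow> bfeas C (a C) (snd s)"
      using vf by (cases rule: vfeas.cases) blast
    have "\<exists>q. a C < k \<and> bij_betw (fst \<circ> q) C ({..<k} - {a C}) \<and> inj_on (snd \<circ> q) C \<and>
        snd s \<notin> (snd \<circ> q) ` C \<and> (\<forall>w\<in>C. vfeas w (fst (q w)) (snd (q w)))"
      if C: "C \<in> classes v" for C
      using a(3)[OF C]
    proof (cases rule: bfeas.cases)
      case (bfeasI pos col)
      then show ?thesis
        by (intro exI[of _ "\<lambda>w. (pos w, col w)"]) (auto simp: comp_def)
    qed
    then obtain q where q: "\<And>C. C \<in> classes v \<Longrightarrow>
        a C < k \<and> bij_betw (fst \<circ> q C) C ({..<k} - {a C}) \<and> inj_on (snd \<circ> q C) C \<and>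
        snd s \<notin> (snd \<circ> q C) ` C \<and> (\<forall>w\<in>C. vfeas w (fst (q C w)) (snd (q C w)))"
      by metis
    \<comment> \<open>Each vertex lies in a single class, so the choices made class by class glue
      together.\<close>
    let ?p = "\<lambda>w. q (cls w) w"
    have eq: "?p w = q C w" if "C \<in> classes v" "w \<in> C" for C w
      using classesD(6)[OF that] by simp
    have "good v s a ?p"
      unfolding good_def
    proof (intro conjI ballI)
      fix C assume C: "C \<in> classes v"
      show "bij_betw (fst \<circ> ?p) C ({..<k} - {a C})"
        using q[OF C] eq[OF C] by (auto simp: bij_betw_def inj_on_def comp_def)
      show "inj_on (snd \<circ> ?p) C"
        using q[OF C] eq[OF C] by (auto simp: inj_on_def comp_def)
      show "snd s \<notin> (snd \<circ> ?p) ` C"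
        using q[OF C] eq[OF C] by (auto simp: comp_def image_iff)
      fix w assume "w \<in> C"
      then show "vfeas w (fst (?p w)) (snd (?p w))" using q[OF C] eq[OF C] by auto
    qed (use a q in auto)
    then show ?thesis by blast
  qed
  then obtain A P where AP: "\<And>v s. vfeas v (fst s) (snd s) \<Longrightarrow> good v s (A v s) (P v s)"
    by metis
  \<comment> \<open>Recursion down the levels: roots start with \<open>(0, 0)\<close>, and every
    other vertex reads its pair off the choice made at its parent.\<close>
  define st where "st = rec_nat (\<lambda>w. (0, 0)) (\<lambda>n f w. P (par w) (f (par w)) w)"
  have st: "st 0 w = (0, 0)" "st (Suc n) w = P (par w) (st n (par w)) w" for n w
    by (simp_all add: st_def)
  define s where "s v = st (lev v) v" for v
  have s_child: "s w = P v (s v) w" if "C \<in> classes v" "w \<in> C" for v C w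
    using classesD(6)[OF that] by (simp add: s_def st)
  have feas: "vfeas v (fst (s v)) (snd (s v))" if "v \<in> V" for v
    using that
  proof (induction "lev v" arbitrary: v)
    case 0
    then show ?case using vfeas_root by (simp add: s_def st flip: 0(1))
  next
    case (Suc n)
    then have v: "0 < lev v" "par v \<in> V" "lev (par v) = n"
      using par_in[of v] lev_par[of v] by auto
    note C = cls_in_classes[OF Suc(3) v(1)] cls_self[OF Suc(3) v(1)]
    have "good (par v) (s (par v)) (A (par v) (s (par v))) (P (par v) (s (par v)))"
      using AP Suc(1) v by auto
    then show ?case using C s_child[OF C] by (auto simp: good_def)
  qed
  show thesis
  proof (rule that[of "fst \<circ> s" "snd \<circ> s" "\<lambda>v. A v (s v)"])
    show "(fst \<circ> s) v = 0" if "lev v = 0" for v using that by (simp add: s_def st)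
    show "(snd \<circ> s) v \<le> 3 * k - 2 \<and> (snd \<circ> s) v = (fst \<circ> s) v + (\<Sum>C\<in>classes v. A v (s v) C)"
      if "v \<in> V" for v using AP[OF feas[OF that]] by (simp add: good_def)
    fix v C assume v: "v \<in> V" and C: "C \<in> classes v"
    show "A v (s v) C < k \<and> bij_betw (fst \<circ> s) C ({..<k} - {A v (s v) C}) \<and>
        inj_on (snd \<circ> s) C \<and> (snd \<circ> s) v \<notin> (snd \<circ> s) ` C"
      using AP[OF feas[OF v]] C s_child[OF C]
      by (auto simp: good_def comp_def bij_betw_def inj_on_def image_iff)
  qed
qed

text \<open>Each edge points from the smaller to the larger position in its block. Then
  \<open>J v\<close> arcs enter \<open>v\<close> from its parent block and \<open>B v C\<close> from
  each class \<open>C\<close> below, so the indegree is \<open>col v\<close>.\<close>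

lemma exists_proper_orientation:
  obtains dir :: "'a \<Rightarrow> 'a \<Rightarrow> bool" where
    "\<And>u w. adj u w \<Longrightarrow> dir u w \<longleftrightarrow> \<not> dir w u"
    "\<And>v. v \<in> V \<Longrightarrow> card {u. adj u v \<and> dir u v} \<le> 3 * k - 2"
    "\<And>u w. adj u w \<Longrightarrow> card {x. adj x u \<and> dir x u} \<noteq> card {x. adj x w \<and> dir x w}"
proof -
  obtain J col B where J0: "\<And>v. \<lbrakk>v \<in> V; lev v = 0\<rbrakk> \<Longrightarrow> J v = 0"
    and col: "\<And>v. v \<in> V \<Longrightarrow> col v \<le> 3 * k - 2 \<and> col v = J v + (\<Sum>C\<in>classes v. B v C)"
    and cl: "\<And>v C. \<lbrakk>v \<in> V; C \<in> classes v\<rbrakk> \<Longrightarrow>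
       B v C < k \<and> bij_betw J C ({..<k} - {B v C}) \<and> inj_on col C \<and> col v \<notin> col ` C"
    using exists_labelling by metis
  \<comment> \<open>Against a child, a parent is compared by its position \<open>B\<close> in their
    common block; its \<open>J\<close> belongs to the block above.\<close>
  define dir where "dir u w \<longleftrightarrow>
      (if 0 < lev w \<and> par w = u then B u (cls w) < J w
       else if 0 < lev u \<and> par u = w then J u < B w (cls u) else J u < J w)" for u w
  have parent: "J w \<noteq> B (par w) (cls w)" "J w < k" "col w \<noteq> col (par w)" if "w \<in> V" "0 < lev w" for w
  proof -
    note C = cls_in_classes[OF that] and w = cls_self[OF that]
    from cl[OF par_in[OF that] C] w
    show "J w \<noteq> B (par w) (cls w)" "J w < k" by (auto simp: bij_betw_def)
    from cl[OF par_in[OF that] C] w show "col w \<noteq> col (par w)" by (metis image_eqI)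
  qed
  have not_both: "\<not> (0 < lev u \<and> par u = w)" if "w \<in> V" "u \<in> V" "0 < lev w" "par w = u" for u w
    using lev_par[OF that(1,3)] lev_par[OF that(2)] that(4) by auto
  have same: "J u \<noteq> J w" "col u \<noteq> col w"
    if "u \<in> V" "w \<in> V" "u \<noteq> w" "0 < lev u" "0 < lev w" "cls u = cls w" for u w
  proof -
    note C = cls_in_classes[OF that(1,4)]
    have "u \<in> cls u" "w \<in> cls u" using cls_self that by auto
    with cl[OF par_in[OF that(1,4)] C] that(3)
    show "J u \<noteq> J w" "col u \<noteq> col w" by (auto simp: bij_betw_def inj_on_def)
  qed
  have indeg: "card {u. adj u v \<and> dir u v} = col v" if v: "v \<in> V" for v
  proof -
    define up where "up = (if 0 < lev v then
        {u \<in> cls v. J u < J v} \<union> (if B (par v) (cls v) < J v then {par v} else {}) else {})"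
    define down where "down C = {u \<in> C. J u < B v C}" for C
    have up_lev: "lev u \<le> lev v" if "u \<in> up" for u
      using that cls_mem[OF v, of u] lev_par[OF v] by (cases "0 < lev v") (auto simp: up_def split: if_splits)
    have down_lev: "lev u = Suc (lev v)" if "C \<in> classes v" "u \<in> down C" for u C
      using that classesD(6) by (auto simp: down_def)
    have "u \<in> up \<union> (\<Union>C\<in>classes v. down C)" if a: "adj u v" "dir u v" for u
    proof -
      have u: "u \<in> V" "0 < lev u \<Longrightarrow> u \<in> cls u" "0 < lev u \<Longrightarrow> cls u \<in> classes (par u)"
        using a cls_self cls_in_classes by (auto simp: adj_def)
      consider "0 < lev v" "par v = u" | "\<not> (0 < lev v \<and> par v = u)" "0 < lev u" "par u = v"
        | "\<not> (0 < lev v \<and> par v = u)" "\<not> (0 < lev u \<and> par u = v)" "0 < lev u" "0 < lev v" "cls u = cls v"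
        using a(1) unfolding adj_def by metis
      then show ?thesis using a(2) u unfolding dir_def up_def down_def by cases auto
    qed
    moreover have "adj u v \<and> dir u v" if u: "u \<in> up" for u
    proof -
      have lv: "0 < lev v" using u by (auto simp: up_def split: if_splits)
      note lp = lev_par[OF v lv, symmetric]
      consider "u \<in> cls v" "J u < J v" | "u = par v" "B (par v) (cls v) < J v"
        using u lv by (auto simp: up_def split: if_splits)
      then show ?thesis
      proof cases
        case 1
        have "lev u = lev v" "par u = par v" "cls u = cls v" "u \<in> V"
          using 1 cls_mem[OF v lv, of u] cls_sub[OF v lv] by auto
        moreover from this have "par v \<noteq> u" "par u \<noteq> v" using lp by auto
        ultimately show ?thesis using 1 lv v unfolding adj_def dir_def by auto
      next
        case 2
        moreover have "par v \<noteq> v" using lp by auto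
        ultimately show ?thesis using lv v par_in[OF v lv] unfolding adj_def dir_def by auto
      qed
    qed
    moreover have "adj u v \<and> dir u v" if "C \<in> classes v" "u \<in> down C" for u C
    proof -
      have "u \<in> V" "lev u = Suc (lev v)" "par u = v" "cls u = C" "J u < B v C"
        using that classesD(1)[OF that(1)] classesD(6)[OF that(1), of u] by (auto simp: down_def)
      moreover have "\<not> (0 < lev v \<and> par v = u)" using not_both[of u v] v calculation by auto
      moreover from calculation have "u \<noteq> v" by auto
      ultimately show ?thesis using v unfolding adj_def dir_def by auto
    qed
    ultimately have "{u. adj u v \<and> dir u v} = up \<union> (\<Union>C\<in>classes v. down C)" by blast
    moreover have "up \<inter> (\<Union>C\<in>classes v. down C) = {}"
      using up_lev down_lev by fastforce
    moreover have "card up = J v \<and> finite up"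
    proof (cases "0 < lev v")
      case True
      note C = cls_in_classes[OF v True] and p = par_in[OF v True]
      have "par v \<notin> cls v" using cls_mem[OF v True, of "par v"] lev_par[OF v True, symmetric] by force
      moreover have "card {u \<in> cls v. J u < J v} = (if B (par v) (cls v) < J v then J v - 1 else J v)"
        using cl[OF p C] parent(2)[OF v True] by (intro card_lessThan_vimage[of J _ k]) auto
      ultimately show ?thesis using True classesD(2)[OF C] by (auto simp: up_def)
    qed (use J0 v in \<open>simp add: up_def\<close>)
    moreover have "card (\<Union>C\<in>classes v. down C) = (\<Sum>C\<in>classes v. B v C)"
    proof -
      have "card (down C) = B v C" if "C \<in> classes v" for C
        using cl[OF v that] card_lessThan_vimage[of J C k "B v C" "B v C"] by (simp add: down_def)
      moreover have "card (\<Union>C\<in>classes v. down C) = (\<Sum>C\<in>classes v. card (down C))"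
        using finite_classes classesD(2) disjoint_classes
        by (intro card_UN_disjoint) (auto simp: down_def, blast+)
      ultimately show ?thesis by simp
    qed
    moreover have "finite (\<Union>C\<in>classes v. down C)"
      using finite_classes classesD(2) by (auto simp: down_def)
    ultimately show ?thesis using col[OF v] by (simp add: card_Un_disjoint)
  qed
  show thesis
  proof (rule that[of dir])
    show "dir u w \<longleftrightarrow> \<not> dir w u" if "adj u w" for u w
      using that parent(1)[of u] parent(1)[of w] same(1)[of u w] not_both[of u w] not_both[of w u]
      unfolding adj_def dir_def by (auto simp: not_less_iff_gr_or_eq)
    show "card {x. adj x u \<and> dir x u} \<noteq> card {x. adj x w \<and> dir x w}" if "adj u w" for u w
      using that parent(3)[of u] parent(3)[of w] same(2)[of u w] indeg[of u] indeg[of w]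
      unfolding adj_def by auto
    show "card {u. adj u v \<and> dir u v} \<le> 3 * k - 2" if "v \<in> V" for v
      using indeg[OF that] col[OF that] by linarith
  qed
qed

end

section \<open>Breadth-first levels\<close>

text \<open>Connectivity of the induced subgraph. The empty set counts as connected, so a singleton
  meets the deletion condition in \<open>ex_clique\<close>.\<close>

definition connected_in :: "('a \<times> 'a) set \<Rightarrow> 'a set \<Rightarrow> bool" where
  "connected_in E S \<longleftrightarrow> (\<forall>u\<in>S. \<forall>w\<in>S. (u, w) \<in> (E \<inter> S \<times> S)\<^sup>*)"

lemma connected_in_clique:
  assumes "\<And>u w. \<lbrakk>u \<in> S; w \<in> S; u \<noteq> w\<rbrakk> \<Longrightarrow> (u, w) \<in> E"
  shows "connected_in E S"
  unfolding connected_in_def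
proof (intro ballI)
  fix u w assume "u \<in> S" "w \<in> S"
  then show "(u, w) \<in> (E \<inter> S \<times> S)\<^sup>*"
    using assms[of u w] by (cases "u = w") auto
qed

lemma connected_in_path:
  assumes "sym E" "successively (\<lambda>u w. (u, w) \<in> E) xs"
  shows "connected_in E (set xs)"
  using assms(2)
proof (induction xs)
  case Nil
  then show ?case by (simp add: connected_in_def)
next
  case (Cons x xs)
  let ?R = "E \<inter> set (x # xs) \<times> set (x # xs)"
  have "sym ?R" using assms(1) by (auto simp: sym_def)
  have "(x, u) \<in> ?R\<^sup>*" if "u \<in> set xs" for u
  proof -
    have ne: "xs \<noteq> []" using that by auto
    have "connected_in E (set xs)" using Cons by (auto simp: successively_Cons)
    then have "(hd xs, u) \<in> (E \<inter> set xs \<times> set xs)\<^sup>*"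
      using that ne by (auto simp: connected_in_def)
    then have "(hd xs, u) \<in> ?R\<^sup>*"
      by (rule rev_subsetD[OF _ rtrancl_mono]) auto
    moreover have "(x, hd xs) \<in> ?R" using Cons(2) ne by (auto simp: successively_Cons)
    ultimately show ?thesis by (rule converse_rtrancl_into_rtrancl[rotated])
  qed
  then have from_x: "(x, u) \<in> ?R\<^sup>*" if "u \<in> set (x # xs)" for u using that by auto
  moreover have "(u, x) \<in> ?R\<^sup>*" if "u \<in> set (x # xs)" for u
    using from_x[OF that] \<open>sym ?R\<close> by (meson symD sym_rtrancl)
  ultimately show ?case unfolding connected_in_def by (meson rtrancl_trans)
qed

text \<open>The level argument uses blocks only through \<open>ex_clique\<close>: a nonempty
  connected set that no single vertex separates lies in a block, which is a clique on
  \<open>k\<close> vertices.\<close>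

locale uniform_cliques =
  fixes V :: "'a set" and E :: "('a \<times> 'a) set" and k :: nat
  assumes finite_verts: "finite V" and edges: "E \<subseteq> V \<times> V"
    and sym: "sym E" and irrefl: "irrefl E"
    and ex_clique: "\<lbrakk>S \<subseteq> V; S \<noteq> {}; connected_in E S; \<And>x. x \<in> S \<Longrightarrow> connected_in E (S - {x})\<rbrakk>
      \<Longrightarrow> \<exists>B. S \<subseteq> B \<and> B \<subseteq> V \<and> card B = k \<and> (\<forall>u\<in>B. \<forall>w\<in>B. u \<noteq> w \<longrightarrow> (u, w) \<in> E)"
begin

lemma symE: "(u, w) \<in> E \<Longrightarrow> (w, u) \<in> E"
  using sym by (rule symD)

lemma not_refl: "(u, u) \<notin> E"
  using irrefl by (simp add: irrefl_def)

text \<open>Deleting \<open>x\<close> from a cycle \<open>ys @ x # zs\<close> leaves the path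
  \<open>zs @ ys\<close>, so \<open>ex_clique\<close> applies to the cycle.\<close>

lemma cycle_clique:
  assumes "successively (\<lambda>u w. (u, w) \<in> E) xs" "distinct xs" "xs \<noteq> []" "(last xs, hd xs) \<in> E"
    and "u \<in> set xs" "w \<in> set xs" "u \<noteq> w"
  shows "(u, w) \<in> E"
proof -
  have "set xs \<subseteq> V"
  proof
    fix x assume "x \<in> set xs"
    then obtain i where i: "i < length xs" "x = xs ! i" by (metis in_set_conv_nth)
    show "x \<in> V"
    proof (cases "Suc i < length xs")
      case True
      then show ?thesis using assms(1) i edges by (auto simp: successively_conv_nth)
    next
      case False
      then have "i = length xs - 1" using i(1) by linarith
      then have "x = last xs" using i(2) assms(3) by (simp add: last_conv_nth)
      then show ?thesis using assms(4) edges by auto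
    qed
  qed
  moreover have "connected_in E (set xs - {x})" if "x \<in> set xs" for x
  proof -
    obtain ys zs where xs: "xs = ys @ x # zs" using \<open>x \<in> set xs\<close> by (meson split_list)
    have "successively (\<lambda>u w. (u, w) \<in> E) ys" "successively (\<lambda>u w. (u, w) \<in> E) zs"
      using assms(1) xs by (cases "zs = []"; simp add: successively_append_iff successively_Cons)+
    moreover have "(last zs, hd ys) \<in> E" if "zs \<noteq> []" "ys \<noteq> []"
      using assms(4) xs that by simp
    ultimately have "successively (\<lambda>u w. (u, w) \<in> E) (zs @ ys)"
      by (auto simp: successively_append_iff)
    then have "connected_in E (set (zs @ ys))" using sym connected_in_path by blast
    moreover have "set (zs @ ys) = set xs - {x}" using assms(2) xs by auto
    ultimately show ?thesis by simp
  qed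
  ultimately obtain B where "set xs \<subseteq> B" "\<forall>u\<in>B. \<forall>w\<in>B. u \<noteq> w \<longrightarrow> (u, w) \<in> E"
    using ex_clique[of "set xs"] assms(1,3) sym connected_in_path by (metis set_empty)
  then show ?thesis using assms(5-7) by blast
qed

section \<open>Distances from a root, parents and classes\<close>

definition root :: "'a \<Rightarrow> 'a" where
  "root v = (SOME u. (u, v) \<in> E\<^sup>*)"

definition lev :: "'a \<Rightarrow> nat" where
  "lev v = (LEAST n. (root v, v) \<in> E ^^ n)"

definition par :: "'a \<Rightarrow> 'a" where
  "par v = (SOME u. (u, v) \<in> E \<and> Suc (lev u) = lev v)"

definition cls :: "'a \<Rightarrow> 'a set" where
  "cls v = {u. lev u = lev v \<and> (u = v \<or> (u, v) \<in> E)}"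

lemma root_reaches: "(root v, v) \<in> E\<^sup>*"
  unfolding root_def by (rule someI[of _ v]) simp

text \<open>By symmetry adjacent vertices are reached from the same vertices, so the choice operator
  is applied to equal predicates.\<close>

lemma root_edge: "(u, v) \<in> E \<Longrightarrow> root u = root v"
  unfolding root_def
  by (rule arg_cong[where f = Eps]) (auto simp: fun_eq_iff dest: symE intro: rtrancl_into_rtrancl)

lemma lev_relpow: "(root v, v) \<in> E ^^ lev v"
  unfolding lev_def using rtrancl_imp_relpow[OF root_reaches] by (rule LeastI_ex)

lemma lev_le: "(root v, v) \<in> E ^^ n \<Longrightarrow> lev v \<le> n"
  unfolding lev_def by (rule Least_le)

lemma lev_0: "lev v = 0 \<Longrightarrow> root v = v"
  using lev_relpow[of v] by simp

lemma lev_edge: "(u, v) \<in> E \<Longrightarrow> lev v \<le> Suc (lev u)"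
  using lev_relpow[of u] root_edge[of u v] by (intro lev_le) auto

lemma par:
  assumes "0 < lev v"
  shows "(par v, v) \<in> E" "Suc (lev (par v)) = lev v"
proof -
  obtain n where n: "lev v = Suc n" using assms gr0_conv_Suc by blast
  then obtain u where u: "(root v, u) \<in> E ^^ n" "(u, v) \<in> E"
    using lev_relpow[of v] by auto
  then have "lev u \<le> n" using root_edge[of u v] lev_le by auto
  then have "(u, v) \<in> E \<and> Suc (lev u) = lev v" using n u lev_edge[of u v] by auto
  then show "(par v, v) \<in> E" "Suc (lev (par v)) = lev v"
    unfolding par_def by (metis (mono_tags, lifting) someI)+
qed

text \<open>Follow parents from both ends until they meet, at the common root at the latest.\<close>

lemma path_below:
  assumes "lev u = n" "lev v = n" "root u = root v" "u \<noteq> v"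
  obtains xs where "successively (\<lambda>u w. (u, w) \<in> E) xs" "distinct xs" "xs \<noteq> []"
    "hd xs = u" "last xs = v" "\<And>x. x \<in> set xs \<Longrightarrow> x = u \<or> x = v \<or> lev x < n"
    "\<exists>x\<in>set xs. lev x < n"
  using assms
proof (induction n arbitrary: u v thesis)
  case 0
  then show ?case using lev_0 by metis
next
  case (Suc n)
  have pu: "(par u, u) \<in> E" "lev (par u) = n" and pv: "(par v, v) \<in> E" "lev (par v) = n"
    using par[of u] par[of v] Suc.prems by auto
  show ?case
  proof (cases "par u = par v")
    case True
    show ?thesis
    proof (rule Suc.prems(1)[of "[u, par u, v]"])
      show "successively (\<lambda>u w. (u, w) \<in> E) [u, par u, v]"
        using True symE[OF pu(1)] pv(1) by simp
      have "u \<noteq> par u" "v \<noteq> par u" using pu(2) Suc.prems(2,3) by force+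
      then show "distinct [u, par u, v]" using Suc.prems(5) by auto
    qed (use pu in auto)
  next
    case False
    have "root (par u) = root (par v)"
      using root_edge[OF pu(1)] root_edge[OF pv(1)] Suc.prems by simp
    then obtain xs where xs: "successively (\<lambda>u w. (u, w) \<in> E) xs" "distinct xs" "xs \<noteq> []"
      "hd xs = par u" "last xs = par v" "\<And>x. x \<in> set xs \<Longrightarrow> x = par u \<or> x = par v \<or> lev x < n"
      using Suc.IH[OF _ pu(2) pv(2)] False by metis
    have low: "lev x < Suc n" if "x \<in> set xs" for x
      using xs(6)[OF that] pu pv by auto
    then have "u \<notin> set xs" "v \<notin> set xs" using low[of u] low[of v] Suc.prems(2,3) by auto
    show ?thesis
    proof (rule Suc.prems(1)[of "u # xs @ [v]"])
      show "successively (\<lambda>u w. (u, w) \<in> E) (u # xs @ [v])"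
        using xs(1,3-5) symE[OF pu(1)] pv(1)
        by (simp add: successively_Cons successively_append_iff)
      show "distinct (u # xs @ [v])"
        using xs(2) \<open>u \<notin> set xs\<close> \<open>v \<notin> set xs\<close> Suc.prems(5) by simp
      show "x = u \<or> x = v \<or> lev x < Suc n" if "x \<in> set (u # xs @ [v])" for x
        using that low by auto
      show "\<exists>x\<in>set (u # xs @ [v]). lev x < Suc n"
        using low hd_in_set[OF xs(3)] by auto
    qed auto
  qed
qed

text \<open>A second lower neighbour would be joined to \<open>par v\<close> by
  \<open>path_below\<close>. Closing that path through \<open>v\<close> gives a cycle, whose clique
  makes \<open>v\<close> adjacent to a vertex at least two levels lower.\<close>

lemma parent_unique:
  assumes "(u, v) \<in> E" "lev u < lev v"
  shows "u = par v"
proof (rule ccontr)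
  assume ne: "u \<noteq> par v"
  have "lev v = Suc (lev u)" using assms lev_edge[of u v] by auto
  moreover have p: "(par v, v) \<in> E" "Suc (lev (par v)) = lev v" using par assms by auto
  moreover have "root u = root (par v)" using root_edge assms p by metis
  ultimately obtain xs where xs: "successively (\<lambda>u w. (u, w) \<in> E) xs" "distinct xs" "xs \<noteq> []"
      "hd xs = u" "last xs = par v" "\<And>x. x \<in> set xs \<Longrightarrow> x = u \<or> x = par v \<or> lev x < lev u"
      "\<exists>x\<in>set xs. lev x < lev u"
    using path_below[of u "lev u" "par v"] ne by (metis Suc_inject)
  obtain z where z: "z \<in> set xs" "lev z < lev u" using xs(7) by blast
  have "v \<notin> set xs" using xs(6) assms p by fastforce
  have "(z, v) \<in> E"
  proof (rule cycle_clique[of "v # xs"])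
    show "successively (\<lambda>u w. (u, w) \<in> E) (v # xs)"
      using xs(1,4) symE[OF assms(1)] by (simp add: successively_Cons)
  qed (use xs(2,3,5) z(1) p(1) \<open>v \<notin> set xs\<close> in auto)
  then show False using lev_edge[of z v] z \<open>lev v = Suc (lev u)\<close> by simp
qed

text \<open>The edge closes the path of \<open>path_below\<close> to a cycle; its clique contains a
  lower vertex adjacent to both ends, which is the parent of each.\<close>

lemma level_edge:
  assumes "(u, v) \<in> E" "lev u = lev v"
  shows "0 < lev v" "par u = par v"
proof -
  have ne: "u \<noteq> v" using assms not_refl by auto
  obtain xs where xs: "successively (\<lambda>u w. (u, w) \<in> E) xs" "distinct xs" "xs \<noteq> []"
      "hd xs = u" "last xs = v" "\<exists>x\<in>set xs. lev x < lev v"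
    using path_below[of u "lev v" v] ne assms root_edge by metis
  then obtain z where z: "z \<in> set xs" "lev z < lev v" by blast
  have "z \<noteq> u" "z \<noteq> v" "u \<in> set xs" "v \<in> set xs" using xs z assms by auto
  then have "(z, u) \<in> E" "(z, v) \<in> E"
    using cycle_clique[OF xs(1-3)] xs(4,5) symE[OF assms(1)] z(1) by auto
  then have "z = par u" "z = par v" using parent_unique z assms by auto
  then show "0 < lev v" "par u = par v" using z by auto
qed

lemma cls_props:
  assumes v: "0 < lev v" and u: "u \<in> cls v"
  shows "lev u = lev v" "par u = par v" "cls u = cls v"
proof -
  show l: "lev u = lev v" using u by (simp add: cls_def)
  show p: "par u = par v" using u level_edge(2)[of u v] by (auto simp: cls_def)
  \<comment> \<open>Three distinct vertices chained on one level form a 4-cycle with their common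
    parent, hence a clique.\<close>
  have trans: "y \<in> cls x" if "y \<in> cls z" "z \<in> cls x" "0 < lev x" for x y z
  proof (cases "y = x \<or> y = z \<or> z = x")
    case True
    then show ?thesis using that by (auto simp: cls_def)
  next
    case False
    then have e: "(y, z) \<in> E" "(z, x) \<in> E" "lev y = lev x" "lev z = lev x" using that by (auto simp: cls_def)
    then have "par y = par x" using level_edge(2) by metis
    moreover have "Suc (lev (par x)) = lev x" "(par x, x) \<in> E" using par[OF that(3)] by auto
    moreover have "(par y, y) \<in> E" using par[of y] e that(3) by simp
    moreover from calculation have "par x \<notin> {x, y, z}" using e by auto
    ultimately have "(y, x) \<in> E"
      using e False symE[of "par x" x] cycle_clique[of "[par x, y, z, x]" y x] by auto
    then show ?thesis using e by (simp add: cls_def)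
  qed
  have "v \<in> cls u" using u symE[of u v] by (auto simp: cls_def)
  moreover have "0 < lev u" using v l by simp
  ultimately show "cls u = cls v" using trans[of _ u v] trans[of _ v u] u v by blast
qed

text \<open>The class and its parent form a clique, contained in a clique \<open>B\<close> on
  \<open>k\<close> vertices. Any vertex of \<open>B\<close> outside it would be adjacent to both
  \<open>v\<close> and \<open>par v\<close>, hence be a lower neighbour of \<open>v\<close> or a
  member of its class.\<close>

lemma card_cls:
  assumes v: "0 < lev v"
  shows "Suc (card (cls v)) = k"
proof -
  let ?K = "insert (par v) (cls v)"
  have pE: "(par v, u) \<in> E" if "u \<in> cls v" for u
    using par[of u] cls_props[OF v that] v by simp
  have clsE: "(u, w) \<in> E" if "u \<in> cls v" "w \<in> cls v" "u \<noteq> w" for u w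
    using cls_props(3)[OF v that(2)] that by (auto simp: cls_def)
  have clique: "(u, w) \<in> E" if "u \<in> ?K" "w \<in> ?K" "u \<noteq> w" for u w
    using that pE clsE symE by blast
  have "v \<in> cls v" by (simp add: cls_def)
  have "?K \<subseteq> V" using pE \<open>v \<in> cls v\<close> edges by blast
  with clique obtain B where B: "?K \<subseteq> B" "B \<subseteq> V" "card B = k" "\<forall>u\<in>B. \<forall>w\<in>B. u \<noteq> w \<longrightarrow> (u, w) \<in> E"
    using ex_clique[of ?K] by (metis connected_in_clique DiffD1 insert_not_empty)
  have "u \<in> ?K" if u: "u \<in> B" for u
  proof (rule ccontr)
    assume n: "u \<notin> ?K"
    then have "u \<noteq> v" "u \<noteq> par v" using \<open>v \<in> cls v\<close> by auto
    then have e: "(u, v) \<in> E" "(par v, u) \<in> E" using B u \<open>v \<in> cls v\<close> by auto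
    then have "lev u \<le> lev v" using lev_edge[OF e(2)] par(2)[OF v] by simp
    then consider "lev u < lev v" | "lev u = lev v" by linarith
    then show False using parent_unique[OF e(1)] e(1) n by cases (auto simp: cls_def)
  qed
  then have "B = ?K" using B(1) by blast
  moreover have "par v \<notin> cls v" using par(2)[OF v] by (auto simp: cls_def)
  moreover have "finite (cls v)" using finite_subset[OF \<open>?K \<subseteq> V\<close> finite_verts] by simp
  ultimately show ?thesis using B(3) by simp
qed

lemma block_forest: "block_forest V k lev par cls"
proof
  fix v assume v: "v \<in> V" "0 < lev v"
  show "par v \<in> V" "lev v = Suc (lev (par v))" using par[OF v(2)] edges by auto
  show "v \<in> cls v" by (simp add: cls_def)
  show "cls v \<subseteq> V" using v edges by (auto simp: cls_def)
  show "lev u = lev v \<and> par u = par v \<and> cls u = cls v" if "u \<in> cls v" for u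
    using cls_props[OF v(2) that] by simp
  show "Suc (card (cls v)) = k" using v card_cls by simp
qed (rule finite_verts)

interpretation block_forest V k lev par cls
  by (rule block_forest)

text \<open>No edge is lost: an edge between levels joins a vertex to its unique parent, an edge
  within a level stays in a class.\<close>

lemma adj_iff: "adj u w \<longleftrightarrow> (u, w) \<in> E"
proof
  assume a: "adj u w"
  then consider "0 < lev w" "par w = u" | "0 < lev u" "par u = w" | "0 < lev u" "0 < lev w" "cls u = cls w"
    unfolding adj_def by metis
  then show "(u, w) \<in> E"
  proof cases
    case 3
    then have "u \<in> cls w" by (auto simp: cls_def)
    then show ?thesis using a by (auto simp: cls_def adj_def)
  qed (use par symE in auto)
next
  assume e: "(u, w) \<in> E"
  then have V: "u \<in> V" "w \<in> V" "u \<noteq> w" using edges not_refl by auto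
  consider "lev u < lev w" | "lev w < lev u" | "lev u = lev w" by linarith
  then show "adj u w"
  proof cases
    case 1
    then show ?thesis using parent_unique[OF e] V by (auto simp: adj_def)
  next
    case 2
    then show ?thesis using parent_unique[OF symE[OF e]] V by (auto simp: adj_def)
  next
    case 3
    then have "0 < lev w" "u \<in> cls w" using level_edge[OF e] e by (auto simp: cls_def)
    then show ?thesis using V cls_props[of w u] 3 by (auto simp: adj_def)
  qed
qed

end

section \<open>Blocks and orientations of graphs\<close>

context graph
begin

lemma arcs_ends_induce: "arcs_ends (G \<restriction> S) = arcs_ends G \<inter> S \<times> S"
  by (auto simp: arcs_ends_conv)

lemma del_vert_induce: "pre_digraph.del_vert (G \<restriction> S) x = G \<restriction> (S - {x})"
  by (auto simp: pre_digraph.del_vert_def induce_subgraph_def)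

lemma reachable_induce:
  assumes "connected_in (arcs_ends G) S" "u \<in> S" "w \<in> S"
  shows "u \<rightarrow>\<^sup>*\<^bsub>G \<restriction> S\<^esub> w"
proof -
  have "(u, w) \<in> (arcs_ends (G \<restriction> S))\<^sup>*"
    using assms by (simp add: connected_in_def arcs_ends_induce)
  then show ?thesis
    unfolding reachable_def
  proof induction
    case base
    then show ?case using assms(2) by simp
  next
    case (step y z)
    then show ?case
      by (elim rtrancl_on_into_rtrancl_on) (auto simp: arcs_ends_induce)
  qed
qed

text \<open>The subgraph induced on \<open>S\<close> is connected without a cut vertex; a largest
  such subgraph of \<open>G\<close> containing it is a block.\<close>

lemma ex_block:
  assumes S: "S \<subseteq> verts G" "S \<noteq> {}" "connected_in (arcs_ends G) S"
    and del: "\<And>x. x \<in> S \<Longrightarrow> connected_in (arcs_ends G) (S - {x})"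
  obtains B where "block G B" "S \<subseteq> verts B"
proof -
  define P where "P H \<longleftrightarrow> graph H \<and> connected H \<and> (\<nexists>v. cut_vertex H v)" for H :: "('a, 'b) pre_digraph"
  let ?H = "G \<restriction> S"
  interpret H: graph ?H
  proof
    show "symmetric ?H"
      using sym_arcs by (auto simp: symmetric_def arcs_ends_induce sym_def)
    show "finite (verts ?H)" using finite_subset[OF S(1)] by simp
    show "e = f" if "e \<in> arcs ?H" "f \<in> arcs ?H" "arc_to_ends ?H e = arc_to_ends ?H f" for e f
      using that no_multi_arcs[of e f] by (simp add: arc_to_ends_def)
  qed (use no_loops in auto)
  have "subgraph ?H G"
    using S(1) by (rule subgraph_induce_subgraphI)
  have "connected ?H"
    unfolding connected_def
    by (intro strongly_connectedI)
      (use S reachable_induce in \<open>auto simp: H.reachable_mk_symmetric_eq[OF H.sym_arcs]\<close>)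
  moreover have "\<not> cut_vertex ?H v" for v
    using reachable_induce[OF del] by (auto simp: cut_vertex_def del_vert_induce)
  ultimately have "P ?H" using H.graph_axioms by (simp add: P_def)
  define Q where "Q H \<longleftrightarrow> P H \<and> subgraph ?H H \<and> subgraph H G" for H
  \<comment> \<open>Counting vertices and arcs together makes every proper extension strictly
    larger.\<close>
  define size where "size H = card (verts H) + card (arcs H)" for H :: "('a, 'b) pre_digraph"
  have "Q ?H" using \<open>P ?H\<close> \<open>subgraph ?H G\<close> H.wf_digraph_axioms
    by (auto simp: Q_def subgraph_def compatible_def)
  moreover have "size H \<le> size G" if "Q H" for H
    using that by (auto simp: Q_def size_def subgraph_def intro!: add_mono card_mono)
  ultimately obtain B where B: "Q B" "\<And>H. Q H \<Longrightarrow> size H \<le> size B"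
    using ex_has_greatest_nat[of Q ?H size "Suc (size G)"] by (metis less_Suc_eq_le)
  have "H' = B" if H': "subgraph B H'" "subgraph H' G" "P H'" for H'
  proof -
    have "subgraph ?H H'" using B(1) H'(1) by (metis Q_def subgraph_trans)
    then have "size H' \<le> size B" using B(2) H' by (simp add: Q_def)
    moreover have fin: "finite (verts H')" "finite (arcs H')"
      using H'(2) by (auto simp: subgraph_def intro: finite_subset)
    moreover have sub: "verts B \<subseteq> verts H'" "arcs B \<subseteq> arcs H'" "compatible H' B"
      using H'(1) by (auto simp: subgraph_def)
    ultimately have "card (verts H') \<le> card (verts B)" "card (arcs H') \<le> card (arcs B)"
      using card_mono[OF fin(1) sub(1)] card_mono[OF fin(2) sub(2)] by (auto simp: size_def)
    then have "verts H' = verts B" "arcs H' = arcs B"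
      using card_seteq fin sub by blast+
    then show ?thesis using sub(3) by (simp add: compatible_def)
  qed
  then have "block G B" using B(1) by (auto simp: block_def max_subgraph_def Q_def P_def)
  moreover have "S \<subseteq> verts B" using B(1) by (auto simp: Q_def subgraph_def)
  ultimately show thesis by (rule that)
qed

lemma proper_k_orientationI:
  assumes anti: "\<And>u w. u \<rightarrow>\<^bsub>G\<^esub> w \<Longrightarrow> dir u w \<longleftrightarrow> \<not> dir w u"
    and bound: "\<And>v. v \<in> verts G \<Longrightarrow> card {u. u \<rightarrow>\<^bsub>G\<^esub> v \<and> dir u v} \<le> n"
    and diff: "\<And>u w. u \<rightarrow>\<^bsub>G\<^esub> w \<Longrightarrow> card {x. x \<rightarrow>\<^bsub>G\<^esub> u \<and> dir x u} \<noteq> card {x. x \<rightarrow>\<^bsub>G\<^esub> w \<and> dir x w}"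
  shows "\<exists>D. proper_k_orientation n G D"
proof -
  define D where "D = G\<lparr>arcs := {e \<in> arcs G. dir (tail G e) (head G e)}\<rparr>"
  have D: "verts D = verts G" "tail D = tail G" "head D = head G"
      "arcs D = {e \<in> arcs G. dir (tail G e) (head G e)}"
    by (simp_all add: D_def)
  have ends: "u \<rightarrow>\<^bsub>D\<^esub> w \<longleftrightarrow> u \<rightarrow>\<^bsub>G\<^esub> w \<and> dir u w" for u w
    by (auto simp: arcs_ends_conv D)
  have deg: "in_degree D v = card {u. u \<rightarrow>\<^bsub>G\<^esub> v \<and> dir u v}" for v
  proof -
    \<comment> \<open>Without parallel arcs, the arcs entering \<open>v\<close> can be counted by
      their tails.\<close>
    have "inj_on (tail G) (in_arcs D v)"
      by (intro inj_onI no_multi_arcs) (auto simp: in_arcs_def arc_to_ends_def D)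
    moreover have "tail G ` in_arcs D v = {u. u \<rightarrow>\<^bsub>G\<^esub> v \<and> dir u v}"
      by (auto simp: in_arcs_def arcs_ends_conv D)
    ultimately show ?thesis by (metis card_image in_degree_def)
  qed
  have "wf_digraph D" by unfold_locales (auto simp: D)
  then have "spanning D G"
    using wf_digraph_axioms by (auto simp: spanning_def subgraph_def compatible_def D)
  then have "proper_k_orientation n G D"
    using anti bound diff graph_symmetric
    unfolding proper_k_orientation_def proper_orientation_def orientation_def deg ends by blast
  then show ?thesis by blast
qed

end

theorem theorem22:
  fixes G :: "('a, 'b) pre_digraph" and k :: nat
  assumes "verts G \<noteq> {}"
    and "uniform_block_graph k G"
  shows "int (proper_orientation_number G) \<le> 3 * int k - 2"
proof -
  interpret graph G using assms(2) by (simp add: uniform_block_graph_def block_graph_def)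
  let ?E = "arcs_ends G"
  have blocks: "card (verts B) = k \<and> (\<forall>u\<in>verts B. \<forall>w\<in>verts B. u \<noteq> w \<longrightarrow> u \<rightarrow>\<^bsub>G\<^esub> w) \<and> verts B \<subseteq> verts G"
    if B: "block G B" for B
  proof -
    have "subgraph B G" using B by (simp add: block_def max_subgraph_def)
    then have "arcs_ends B \<subseteq> ?E" by (auto simp: arcs_ends_conv subgraph_def compatible_def)
    moreover obtain n where "complete_digraph n B"
      using B assms(2) by (auto simp: uniform_block_graph_def block_graph_def)
    ultimately show ?thesis
      using B assms(2) \<open>subgraph B G\<close>
      by (auto simp: uniform_block_graph_def complete_digraph_def subgraph_def)
  qed
  interpret uniform_cliques "verts G" ?E k
  proof
    show "?E \<subseteq> verts G \<times> verts G" by auto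
    show "sym ?E" using sym_arcs by (simp add: symmetric_def)
    show "irrefl ?E" using adj_not_same by (auto simp: irrefl_def)
    fix S assume "S \<subseteq> verts G" "S \<noteq> {}" "connected_in ?E S" "\<And>x. x \<in> S \<Longrightarrow> connected_in ?E (S - {x})"
    then show "\<exists>B. S \<subseteq> B \<and> B \<subseteq> verts G \<and> card B = k \<and> (\<forall>u\<in>B. \<forall>w\<in>B. u \<noteq> w \<longrightarrow> (u, w) \<in> ?E)"
      using blocks by (metis ex_block)
  qed simp
  interpret block_forest "verts G" k lev par cls by (rule block_forest)
  \<comment> \<open>A singleton lies in some block, so \<open>k\<close> is positive and the
    truncated \<open>3 * k - 2\<close> agrees with the integer value.\<close>
  obtain v where "v \<in> verts G" using assms(1) by blast
  then obtain B where "block G B" "v \<in> verts B"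
    using ex_block[of "{v}"] by (auto simp: connected_in_def)
  then have "0 < k"
    using blocks[of B] finite_subset[of "verts B" "verts G"] by (auto simp: card_gt_0_iff)
  obtain dir where "\<And>u w. adj u w \<Longrightarrow> dir u w \<longleftrightarrow> \<not> dir w u"
    "\<And>v. v \<in> verts G \<Longrightarrow> card {u. adj u v \<and> dir u v} \<le> 3 * k - 2"
    "\<And>u w. adj u w \<Longrightarrow> card {x. adj x u \<and> dir x u} \<noteq> card {x. adj x w \<and> dir x w}"
    by (rule exists_proper_orientation, rule that)
  then have "\<exists>D. proper_k_orientation (3 * k - 2) G D"
    unfolding adj_iff by (rule proper_k_orientationI)
  then have "proper_orientation_number G \<le> 3 * k - 2"
    unfolding proper_orientation_number_def by (rule Least_le)
  then show ?thesis using \<open>0 < k\<close> by linarith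
qed

end
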